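(* Let $h>0$ and $Z_h:=\,]-h,h[\,\times S^1$. Assume $u\in C^\infty(Z_h,\mathbb{C}^n)$ satisfies $$|\Delta u(s,\theta)|^2\le M\Big[|u(s,\theta)|^2+|\nabla u(s,\theta)|^2+\int_{S^1}|u(s,\tau)|^2\,d\tau\Big]$$ for all $(s,\theta)\in Z_h$, where $M>0$ is a positive constant. If $u$ vanishes together with all its derivatives on $\{0\}\times S^1$, then $u\equiv0$ on $Z_h$.
   Context: $(s,\theta)$ are the standard coordinates on $Z_h=\,]-h,h[\,\times S^1$, $\Delta=\partial_s^2+\partial_\theta^2$, and $|\nabla u|^2=|\partial_su|^2+|\partial_\theta u|^2$. *)

theory Defs
  imports "HOL-Analysis.Analysis"
begin

text \<open>The circle is the unit circle of the complex plane, with angular coordinate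
  \<open>\<theta> \<mapsto> cis \<theta>\<close> of period \<open>2\<pi>\<close>.\<close>

definition cylinder :: "real \<Rightarrow> (real \<times> complex) set" where
  "cylinder h = {-h<..<h} \<times> sphere 0 1"

definition in_coords :: "(real \<times> complex \<Rightarrow> 'a) \<Rightarrow> real \<times> real \<Rightarrow> 'a" where
  "in_coords u = (\<lambda>(s, \<theta>). u (s, cis \<theta>))"

text \<open>Being of class \<open>C\<^sup>k\<close> on an open set: \<open>v\<close> ranges over all directions, so the
  condition concerns all iterated directional derivatives up to order \<open>k\<close>.\<close>

primrec Ck_on ::
  "nat \<Rightarrow> 'a::euclidean_space set \<Rightarrow> ('a \<Rightarrow> 'b::real_normed_vector) \<Rightarrow> bool" where
  "Ck_on 0 S f \<longleftrightarrow> continuous_on S f"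
| "Ck_on (Suc k) S f \<longleftrightarrow>
     (\<forall>x\<in>S. f differentiable at x) \<and> (\<forall>v. Ck_on k S (\<lambda>x. frechet_derivative f (at x) v))"

definition Cinf_on :: "'a::euclidean_space set \<Rightarrow> ('a \<Rightarrow> 'b::real_normed_vector) \<Rightarrow> bool" where
  "Cinf_on S f \<longleftrightarrow> (\<forall>k. Ck_on k S f)"

text \<open>Since \<open>(s, \<theta>) \<mapsto> (s, cis \<theta>)\<close> is a smooth covering map and a local diffeomorphism, a
  function on the cylinder is smooth iff its pullback to the strip is.\<close>

definition smooth_on_cylinder ::
  "real \<Rightarrow> (real \<times> complex \<Rightarrow> 'a::real_normed_vector) \<Rightarrow> bool" where
  "smooth_on_cylinder h u \<longleftrightarrow> Cinf_on ({-h<..<h} \<times> UNIV) (in_coords u)"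

definition d_s :: "(real \<times> real \<Rightarrow> 'a::real_normed_vector) \<Rightarrow> real \<times> real \<Rightarrow> 'a" where
  "d_s f = (\<lambda>(s, \<theta>). vector_derivative (\<lambda>t. f (t, \<theta>)) (at s))"

definition d_theta :: "(real \<times> real \<Rightarrow> 'a::real_normed_vector) \<Rightarrow> real \<times> real \<Rightarrow> 'a" where
  "d_theta f = (\<lambda>(s, \<theta>). vector_derivative (\<lambda>t. f (s, t)) (at \<theta>))"

definition laplacian :: "(real \<times> real \<Rightarrow> 'a::real_normed_vector) \<Rightarrow> real \<times> real \<Rightarrow> 'a" where
  "laplacian f p = d_s (d_s f) p + d_theta (d_theta f) p"

definition grad_norm_sq :: "(real \<times> real \<Rightarrow> 'a::real_normed_vector) \<Rightarrow> real \<times> real \<Rightarrow> real" where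
  "grad_norm_sq f p = (norm (d_s f p))\<^sup>2 + (norm (d_theta f p))\<^sup>2"

end

theory Submission
  imports Defs "HOL-Real_Asymp.Real_Asymp"
begin

text \<open>A Carleman estimate with the weight \<open>exp (2 l \<phi>)\<close>, \<open>\<phi> s = (s - h - 1)\<^sup>2\<close>, which depends on
  \<open>s\<close> only, so that the nonlocal term, once integrated over the circle, is controlled like \<open>\<bar>u\<bar>\<^sup>2\<close>.
  The estimate is a pointwise identity modulo a divergence. Integrating over the circle removes
  the \<open>\<theta>\<close>-part and shows that for large \<open>l\<close> the weighted flux \<open>G\<^sub>l\<close> of the \<open>s\<close>-part satisfies
  \<open>G\<^sub>l' \<le> - exp (2 l \<phi>) \<integral> \<bar>u\<bar>\<^sup>2 d\<theta>\<close> for \<open>0 \<le> s < h\<close>. As \<open>G\<^sub>l 0 = 0\<close> and \<open>- G\<^sub>l T\<close> is at most a constant times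
  \<open>l exp (2 l \<phi> T)\<close>, and since \<open>\<phi>\<close> decreases, letting \<open>l\<close> tend to infinity forces \<open>u = 0\<close> on \<open>[0, t]\<close>
  for all \<open>t < T < h\<close>, without any cutoff function. Negative \<open>s\<close> follow by reflection.\<close>

section \<open>Regularity on the strip\<close>

text \<open>Derivatives at a point of an open set depend only on values in that set, so induction on
  \<open>k\<close> works. This is needed because \<open>d_s f\<close> and \<open>d_theta f\<close>
  are identified with Frechet derivatives only on the strip.\<close>

lemma Ck_on_cong:
  assumes "open S" "\<And>x. x \<in> S \<Longrightarrow> f x = g x" "Ck_on k S f"
  shows "Ck_on k S g"
  using assms(2,3)
proof (induction k arbitrary: f g)
  case 0
  then show ?case by (simp cong: continuous_on_cong)
next
  case (Suc k)
  have fd: "f differentiable at x" if "x \<in> S" for x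
    using Suc.prems(2) that by simp
  have "g differentiable at x" if "x \<in> S" for x
  proof -
    have "f differentiable at x" by (rule fd[OF that])
    then obtain D where "(f has_derivative D) (at x)"
      by (auto simp: differentiable_def)
    from has_derivative_transform_within_open[OF this assms(1) that Suc.prems(1)]
    show ?thesis by (auto simp: differentiable_def)
  qed
  moreover have "Ck_on k S (\<lambda>x. frechet_derivative g (at x) v)" for v
  proof (rule Suc.IH)
    show "Ck_on k S (\<lambda>x. frechet_derivative f (at x) v)"
      using Suc.prems(2) by simp
    show "frechet_derivative f (at x) v = frechet_derivative g (at x) v" if "x \<in> S" for x
      using frechet_derivative_transform_within_open[OF fd[OF that] assms(1) that Suc.prems(1)]
      by simp
  qed
  ultimately show ?case by simp
qed

lemma Cinf_on_continuous: "Cinf_on S f \<Longrightarrow> continuous_on S f"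
  unfolding Cinf_on_def by (drule spec[of _ 0]) simp

lemma Cinf_on_differentiable: "Cinf_on S f \<Longrightarrow> x \<in> S \<Longrightarrow> f differentiable at x"
  unfolding Cinf_on_def by (drule spec[of _ "Suc 0"]) simp

lemma Cinf_on_frechet_derivative:
  "Cinf_on S f \<Longrightarrow> Cinf_on S (\<lambda>x. frechet_derivative f (at x) v)"
  unfolding Cinf_on_def using Ck_on.simps(2)[THEN iffD1] by metis

lemma Cinf_on_cong:
  assumes "open S" "\<And>x. x \<in> S \<Longrightarrow> f x = g x" "Cinf_on S f"
  shows "Cinf_on S g"
  unfolding Cinf_on_def
proof
  fix k
  show "Ck_on k S g"
    by (rule Ck_on_cong[OF assms(1,2)]) (use assms(3) in \<open>auto simp: Cinf_on_def\<close>)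
qed

lemma has_vector_derivative_fst:
  fixes f :: "real \<times> real \<Rightarrow> 'a::real_normed_vector"
  assumes "f differentiable at (s, \<theta>)"
  shows "((\<lambda>t. f (t, \<theta>)) has_vector_derivative frechet_derivative f (at (s, \<theta>)) (1, 0)) (at s)"
proof -
  have f: "(f has_derivative frechet_derivative f (at (s, \<theta>))) (at (s, \<theta>))"
    using assms frechet_derivative_works by blast
  have "((\<lambda>t. (t, \<theta>)) has_vector_derivative (1, 0)) (at s)"
    unfolding has_vector_derivative_def
    by (auto intro!: derivative_eq_intros simp: zero_prod_def)
  from vector_derivative_diff_chain_within[OF this has_derivative_at_withinI[OF f]]
  show ?thesis by (simp add: o_def)
qed

lemma has_vector_derivative_snd:
  fixes f :: "real \<times> real \<Rightarrow> 'a::real_normed_vector"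
  assumes "f differentiable at (s, \<theta>)"
  shows "((\<lambda>t. f (s, t)) has_vector_derivative frechet_derivative f (at (s, \<theta>)) (0, 1)) (at \<theta>)"
proof -
  have f: "(f has_derivative frechet_derivative f (at (s, \<theta>))) (at (s, \<theta>))"
    using assms frechet_derivative_works by blast
  have "((\<lambda>t. (s, t)) has_vector_derivative (0, 1)) (at \<theta>)"
    unfolding has_vector_derivative_def
    by (auto intro!: derivative_eq_intros simp: zero_prod_def)
  from vector_derivative_diff_chain_within[OF this has_derivative_at_withinI[OF f]]
  show ?thesis by (simp add: o_def)
qed

text \<open>Passes from directional Frechet derivatives, which \<open>Cinf_on\<close> speaks of, to
  the one-variable derivative \<open>d_s\<close>; the direction is \<open>(1, 0)\<close>.\<close>

lemma Cinf_on_d_s: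
  assumes "open S" "Cinf_on S f"
  shows "Cinf_on S (d_s f)"
    and "(s, \<theta>) \<in> S \<Longrightarrow> ((\<lambda>t. f (t, \<theta>)) has_vector_derivative d_s f (s, \<theta>)) (at s)"
proof -
  have eq: "frechet_derivative f (at x) (1, 0) = d_s f x" if "x \<in> S" for x
    using has_vector_derivative_fst[of f "fst x" "snd x"] Cinf_on_differentiable[OF assms(2) that]
    by (auto simp: d_s_def split_beta vector_derivative_at)
  show "Cinf_on S (d_s f)"
    by (rule Cinf_on_cong[OF assms(1) eq Cinf_on_frechet_derivative[OF assms(2)]])
  show "((\<lambda>t. f (t, \<theta>)) has_vector_derivative d_s f (s, \<theta>)) (at s)" if "(s, \<theta>) \<in> S"
    using has_vector_derivative_fst[OF Cinf_on_differentiable[OF assms(2) that]] eq[OF that]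
    by simp
qed

lemma Cinf_on_d_theta:
  assumes "open S" "Cinf_on S f"
  shows "Cinf_on S (d_theta f)"
    and "(s, \<theta>) \<in> S \<Longrightarrow> ((\<lambda>t. f (s, t)) has_vector_derivative d_theta f (s, \<theta>)) (at \<theta>)"
proof -
  have eq: "frechet_derivative f (at x) (0, 1) = d_theta f x" if "x \<in> S" for x
    using has_vector_derivative_snd[of f "fst x" "snd x"] Cinf_on_differentiable[OF assms(2) that]
    by (auto simp: d_theta_def split_beta vector_derivative_at)
  show "Cinf_on S (d_theta f)"
    by (rule Cinf_on_cong[OF assms(1) eq Cinf_on_frechet_derivative[OF assms(2)]])
  show "((\<lambda>t. f (s, t)) has_vector_derivative d_theta f (s, \<theta>)) (at \<theta>)" if "(s, \<theta>) \<in> S"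
    using has_vector_derivative_snd[OF Cinf_on_differentiable[OF assms(2) that]] eq[OF that]
    by simp
qed

lemma continuous_on_slice:
  assumes "continuous_on (A \<times> UNIV) f" "s \<in> A"
  shows "continuous_on B (\<lambda>t. f (s, t))"
  by (rule continuous_on_compose2[OF assms(1)]) (use assms(2) in \<open>auto intro!: continuous_intros\<close>)

lemma has_vector_derivative_integral_param:
  fixes f f' :: "real \<times> real \<Rightarrow> 'a::banach"
  assumes cont: "continuous_on ({a<..<b} \<times> UNIV) f" "continuous_on ({a<..<b} \<times> UNIV) f'"
    and deriv: "\<And>s \<theta>. s \<in> {a<..<b} \<Longrightarrow>
      ((\<lambda>t. f (t, \<theta>)) has_vector_derivative f' (s, \<theta>)) (at s)"
    and s: "s \<in> {a<..<b}"
  shows "((\<lambda>s. integral {c..d} (\<lambda>\<theta>. f (s, \<theta>))) has_vector_derivative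
           integral {c..d} (\<lambda>\<theta>. f' (s, \<theta>))) (at s)"
proof -
  have "((\<lambda>s. integral (cbox c d) (\<lambda>\<theta>. f (s, \<theta>))) has_vector_derivative
           integral (cbox c d) (\<lambda>\<theta>. f' (s, \<theta>))) (at s within {a<..<b})"
  proof (rule leibniz_rule_vector_derivative)
    show "((\<lambda>x. f (x, t)) has_vector_derivative f' (x, t)) (at x within {a<..<b})"
      if "x \<in> {a<..<b}" for x t
      using deriv[OF that] by (rule has_vector_derivative_at_within)
    show "(\<lambda>\<theta>. f (x, \<theta>)) integrable_on cbox c d" if "x \<in> {a<..<b}" for x
      by (rule integrable_continuous) (rule continuous_on_slice[OF cont(1) that])
    show "continuous_on ({a<..<b} \<times> cbox c d) (\<lambda>(x, t). f' (x, t))"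
      unfolding case_prod_eta[of f'] by (rule continuous_on_subset[OF cont(2)]) auto
  qed (use s in auto)
  then show ?thesis
    unfolding at_within_open[OF s open_greaterThanLessThan] by simp
qed

text \<open>Schwarz's theorem through integration: \<open>f (r, x) - f (r, c)\<close> is the
  integral of \<open>ft\<close> over \<open>{c..x}\<close>. Differentiating in \<open>r\<close>
  under the integral sign gives \<open>fs (s, x) - fs (s, c)\<close> as the integral of
  \<open>fst'\<close>; differentiating in \<open>x\<close> then gives the claim.\<close>

lemma mixed_partials_commute:
  fixes f fs ft fst' fts :: "real \<times> real \<Rightarrow> 'a::banach"
  assumes cont: "continuous_on ({a<..<b} \<times> UNIV) ft" "continuous_on ({a<..<b} \<times> UNIV) fst'"
    and fs: "\<And>s \<theta>. s \<in> {a<..<b} \<Longrightarrow> ((\<lambda>t. f (t, \<theta>)) has_vector_derivative fs (s, \<theta>)) (at s)"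
    and ft: "\<And>s \<theta>. s \<in> {a<..<b} \<Longrightarrow> ((\<lambda>t. f (s, t)) has_vector_derivative ft (s, \<theta>)) (at \<theta>)"
    and fst': "\<And>s \<theta>. s \<in> {a<..<b} \<Longrightarrow> ((\<lambda>t. ft (t, \<theta>)) has_vector_derivative fst' (s, \<theta>)) (at s)"
    and fts: "\<And>s \<theta>. s \<in> {a<..<b} \<Longrightarrow> ((\<lambda>t. fs (s, t)) has_vector_derivative fts (s, \<theta>)) (at \<theta>)"
    and s: "s \<in> {a<..<b}"
  shows "fst' (s, \<theta>) = fts (s, \<theta>)"
proof -
  \<comment> \<open>Any base point left of \<theta> serves: \<theta> must be interior to the range
    of \<open>x\<close> where \<open>I\<close> holds, to obtain a two-sided derivative.\<close>
  define c where "c = \<theta> - 1"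
  have I: "integral {c..x} (\<lambda>\<tau>. fst' (s, \<tau>)) = fs (s, x) - fs (s, c)" if "c \<le> x" for x
  proof -
    have ftc: "integral {c..x} (\<lambda>\<tau>. ft (r, \<tau>)) = f (r, x) - f (r, c)" if "r \<in> {a<..<b}" for r
      by (rule integral_unique, rule fundamental_theorem_of_calculus[OF \<open>c \<le> x\<close>])
        (rule has_vector_derivative_at_within[OF ft[OF that]])
    have "((\<lambda>r. f (r, x) - f (r, c)) has_vector_derivative integral {c..x} (\<lambda>\<tau>. fst' (s, \<tau>))) (at s)"
      by (rule has_vector_derivative_transform_within_open[OF
            has_vector_derivative_integral_param[OF cont fst' s] open_greaterThanLessThan s ftc])
    moreover have "((\<lambda>r. f (r, x) - f (r, c)) has_vector_derivative fs (s, x) - fs (s, c)) (at s)"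
      by (intro has_vector_derivative_diff fs s)
    ultimately show ?thesis
      by (rule vector_derivative_unique_at)
  qed
  have "((\<lambda>x. integral {c..x} (\<lambda>\<tau>. fst' (s, \<tau>))) has_vector_derivative fst' (s, \<theta>))
      (at \<theta> within {c..\<theta> + 1})"
    by (rule integral_has_vector_derivative)
      (auto intro: continuous_on_slice[OF cont(2) s] simp: c_def)
  then have "((\<lambda>x. integral {c..x} (\<lambda>\<tau>. fst' (s, \<tau>))) has_vector_derivative fst' (s, \<theta>)) (at \<theta>)"
    by (subst (asm) at_within_interior) (auto simp: c_def)
  then have 1: "((\<lambda>x. fs (s, x) - fs (s, c)) has_vector_derivative fst' (s, \<theta>)) (at \<theta>)"
    by (rule has_vector_derivative_transform_within_open[where S = "{c<..}"])
      (simp_all add: c_def I[unfolded c_def])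
  have 2: "((\<lambda>x. fs (s, x) - fs (s, c)) has_vector_derivative fts (s, \<theta>) - 0) (at \<theta>)"
    by (intro has_vector_derivative_diff fts s has_vector_derivative_const)
  from vector_derivative_unique_at[OF 1 2] show ?thesis by simp
qed

section \<open>The Carleman estimate\<close>

text \<open>For \<open>w = exp (l \<phi>) u\<close> with \<open>\<phi>' = p\<close>, \<open>\<phi>'' = 2\<close>, the two squares at the end are
  \<open>\<bar>S w + l w\<bar>\<^sup>2\<close> and \<open>\<bar>A w\<bar>\<^sup>2\<close> (up to the weight), where \<open>S\<close> and \<open>A\<close> are the symmetric and
  antisymmetric parts of the conjugated Laplacian. The letters \<open>a\<close>, \<open>b\<close>, \<open>c\<close>, \<open>d\<close>, \<open>e\<close>, \<open>f\<close> stand for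
  \<open>u\<close>, \<open>u\<^sub>s\<close>, \<open>u\<^sub>\<theta>\<close>, \<open>u\<^sub>s\<^sub>s\<close>, \<open>u\<^sub>s\<^sub>\<theta>\<close>, \<open>u\<^sub>\<theta>\<^sub>\<theta>\<close>.\<close>

lemma carleman_identity:
  fixes a b c d e f :: "'b::real_inner" and p l :: real
  defines "v \<equiv> b + (l * p) *\<^sub>R a" and "v' \<equiv> d + (l * p) *\<^sub>R b + (2 * l) *\<^sub>R a"
  shows "(norm (d + f))\<^sup>2 =
    (2 * l * p * (- 2 * l * p * (v \<bullet> v) - 6 * l * (a \<bullet> v) + 2 * l * p * (c \<bullet> c) - 2 * l^3 * p^3 * (a \<bullet> a))
      - 4 * l * (v \<bullet> v) - 4 * l * p * (v \<bullet> v') - 6 * l * (b \<bullet> v) - 6 * l * (a \<bullet> v')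
      + 4 * l * (c \<bullet> c) + 4 * l * p * (c \<bullet> e) - 12 * l^3 * p^2 * (a \<bullet> a) - 4 * l^3 * p^3 * (a \<bullet> b))
    - l * (f \<bullet> ((4 * p) *\<^sub>R v + 6 *\<^sub>R a) + c \<bullet> ((4 * p) *\<^sub>R (e + (l * p) *\<^sub>R c) + 6 *\<^sub>R c))
    + 10 * l * (v \<bullet> v) + 2 * l * (c \<bullet> c) + (6 * l^3 * p^2 - l^2) * (a \<bullet> a)
    + (norm (d + f + (2 * l * p) *\<^sub>R b + (3 * l + 2 * l^2 * p^2) *\<^sub>R a))\<^sup>2
    + (norm ((2 * l * p) *\<^sub>R v + (2 * l) *\<^sub>R a))\<^sup>2"
  \<comment> \<open>Bilinearity and a fixed order within each pair leave a polynomial identity in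
    \<open>p\<close>, \<open>l\<close> and the inner products.\<close>
  unfolding v_def v'_def power2_norm_eq_inner inner_simps
    inner_commute[of b a] inner_commute[of c a] inner_commute[of d a] inner_commute[of e a]
    inner_commute[of f a] inner_commute[of c b] inner_commute[of d b] inner_commute[of e b]
    inner_commute[of f b] inner_commute[of d c] inner_commute[of e c] inner_commute[of f c]
    inner_commute[of e d] inner_commute[of f d] inner_commute[of f e]
  by algebra

text \<open>The two squares are dropped, and the remaining quadratic terms dominate \<open>l\<close>
  times the full first-order norm. The commutator of \<open>S\<close> and \<open>A\<close> yields no
  \<open>c \<bullet> c\<close> term; the shift by \<open>l\<close> in the first square supplies
  \<open>2 * l * (c \<bullet> c)\<close> at the price of
  \<open>- l^2 * (a \<bullet> a)\<close>.\<close>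

lemma carleman_pointwise:
  fixes a b c d e f :: "'b::real_inner" and p l :: real
  assumes l: "l \<ge> 1" and p: "p\<^sup>2 \<ge> 4"
  defines "v \<equiv> b + (l * p) *\<^sub>R a" and "v' \<equiv> d + (l * p) *\<^sub>R b + (2 * l) *\<^sub>R a"
  shows "(2 * l * p * (- 2 * l * p * (v \<bullet> v) - 6 * l * (a \<bullet> v) + 2 * l * p * (c \<bullet> c) - 2 * l^3 * p^3 * (a \<bullet> a))
      - 4 * l * (v \<bullet> v) - 4 * l * p * (v \<bullet> v') - 6 * l * (b \<bullet> v) - 6 * l * (a \<bullet> v')
      + 4 * l * (c \<bullet> c) + 4 * l * p * (c \<bullet> e) - 12 * l^3 * p^2 * (a \<bullet> a) - 4 * l^3 * p^3 * (a \<bullet> b))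
    - l * (f \<bullet> ((4 * p) *\<^sub>R v + 6 *\<^sub>R a) + c \<bullet> ((4 * p) *\<^sub>R (e + (l * p) *\<^sub>R c) + 6 *\<^sub>R c))
    + l * ((norm b)\<^sup>2 + (norm c)\<^sup>2 + (norm a)\<^sup>2) \<le> (norm (d + f))\<^sup>2"
proof -
  \<comment> \<open>This is the parallelogram bound for
    \<open>b = v - (l * p) *\<^sub>R a\<close>.\<close>
  have b: "(norm b)\<^sup>2 \<le> 2 * (v \<bullet> v) + 2 * l\<^sup>2 * p\<^sup>2 * (a \<bullet> a)"
  proof -
    have "2 * (v \<bullet> v) + 2 * l\<^sup>2 * p\<^sup>2 * (a \<bullet> a) - (norm b)\<^sup>2 = (norm (b + (2 * l * p) *\<^sub>R a))\<^sup>2"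
      unfolding v_def power2_norm_eq_inner inner_simps
      by (simp add: inner_commute algebra_simps power2_eq_square)
    then show ?thesis
      by (smt (verit) zero_le_power2)
  qed
  have "l ^ 1 \<le> l ^ 3" "l\<^sup>2 \<le> l ^ 3" "0 \<le> l ^ 3"
    using l by (intro power_increasing zero_le_power; simp)+
  moreover have "l ^ 3 * 4 \<le> l ^ 3 * p\<^sup>2"
    using l p by (intro mult_left_mono) auto
  \<comment> \<open>Of the coefficient \<open>6 * l^3 * p^2\<close> of \<open>a \<bullet> a\<close>,
    the bound on \<open>b\<close> consumes \<open>2 * l^3 * p^2\<close>; the rest must cover
    \<open>l\<close> and the loss \<open>l^2\<close>.\<close>
  ultimately have "l + l\<^sup>2 \<le> 4 * l^3 * p\<^sup>2"
    by simp
  then have "(l + l\<^sup>2) * (a \<bullet> a) \<le> 4 * l^3 * p\<^sup>2 * (a \<bullet> a)"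
    by (rule mult_right_mono) simp
  moreover have "l * (norm b)\<^sup>2 \<le> l * (2 * (v \<bullet> v) + 2 * l\<^sup>2 * p\<^sup>2 * (a \<bullet> a))"
    using b l by (intro mult_left_mono) auto
  moreover have "0 \<le> l * (v \<bullet> v)" "0 \<le> l * (c \<bullet> c)"
    using l by auto
  ultimately have *: "l * ((norm b)\<^sup>2 + (norm c)\<^sup>2 + (norm a)\<^sup>2)
      \<le> 10 * l * (v \<bullet> v) + 2 * l * (c \<bullet> c) + (6 * l^3 * p^2 - l^2) * (a \<bullet> a)"
    unfolding power2_norm_eq_inner by (simp add: algebra_simps power2_eq_square power3_eq_cube)
  have "0 \<le> (norm (d + f + (2 * l * p) *\<^sub>R b + (3 * l + 2 * l^2 * p^2) *\<^sub>R a))\<^sup>2"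
    "0 \<le> (norm ((2 * l * p) *\<^sub>R v + (2 * l) *\<^sub>R a))\<^sup>2"
    by auto
  with * show ?thesis
    using carleman_identity[of d f l p b a c e, folded v_def v'_def] by linarith
qed

text \<open>The derivatives are parameters, so that the reflected function is an instance with its
  own signs. Symmetry of second derivatives is built in: \<open>ust\<close> is both the s-derivative
  of \<open>ut\<close> and the \<theta>-derivative of \<open>us\<close>.\<close>

locale strip_function =
  fixes h :: real and u us ut uss ust utt :: "real \<times> real \<Rightarrow> 'b::real_inner"
  assumes cont: "continuous_on ({-h<..<h} \<times> UNIV) u" "continuous_on ({-h<..<h} \<times> UNIV) us"
      "continuous_on ({-h<..<h} \<times> UNIV) ut" "continuous_on ({-h<..<h} \<times> UNIV) uss"
      "continuous_on ({-h<..<h} \<times> UNIV) ust" "continuous_on ({-h<..<h} \<times> UNIV) utt"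
    and deriv_s:
      "\<And>s \<theta>. s \<in> {-h<..<h} \<Longrightarrow> ((\<lambda>t. u (t, \<theta>)) has_vector_derivative us (s, \<theta>)) (at s)"
      "\<And>s \<theta>. s \<in> {-h<..<h} \<Longrightarrow> ((\<lambda>t. us (t, \<theta>)) has_vector_derivative uss (s, \<theta>)) (at s)"
      "\<And>s \<theta>. s \<in> {-h<..<h} \<Longrightarrow> ((\<lambda>t. ut (t, \<theta>)) has_vector_derivative ust (s, \<theta>)) (at s)"
    and deriv_t:
      "\<And>s \<theta>. s \<in> {-h<..<h} \<Longrightarrow> ((\<lambda>t. u (s, t)) has_vector_derivative ut (s, \<theta>)) (at \<theta>)"
      "\<And>s \<theta>. s \<in> {-h<..<h} \<Longrightarrow> ((\<lambda>t. us (s, t)) has_vector_derivative ust (s, \<theta>)) (at \<theta>)"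
      "\<And>s \<theta>. s \<in> {-h<..<h} \<Longrightarrow> ((\<lambda>t. ut (s, t)) has_vector_derivative utt (s, \<theta>)) (at \<theta>)"
    and periodic: "\<And>s. u (s, 2 * pi) = u (s, 0)" "\<And>s. us (s, 2 * pi) = us (s, 0)"
      "\<And>s. ut (s, 2 * pi) = ut (s, 0)"
begin

text \<open>Reflection preserves the Laplacian, the norms and the circle integrals, so negative
  \<open>s\<close> reduces to positive \<open>s\<close>. Each s-derivative contributes one
  sign.\<close>

lemma reflect:
  "strip_function h (\<lambda>(s, \<theta>). u (-s, \<theta>)) (\<lambda>(s, \<theta>). - us (-s, \<theta>)) (\<lambda>(s, \<theta>). ut (-s, \<theta>))
     (\<lambda>(s, \<theta>). uss (-s, \<theta>)) (\<lambda>(s, \<theta>). - ust (-s, \<theta>)) (\<lambda>(s, \<theta>). utt (-s, \<theta>))"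
proof -
  have c: "continuous_on ({-h<..<h} \<times> UNIV) (\<lambda>(s, \<theta>). f (-s, \<theta>))"
    if "continuous_on ({-h<..<h} \<times> UNIV) f" for f :: "real \<times> real \<Rightarrow> 'b"
    unfolding split_beta
    by (rule continuous_on_compose2[OF that]) (auto intro!: continuous_intros)
  have d: "((\<lambda>t. f (-t, \<theta>)) has_vector_derivative - f' (-s, \<theta>)) (at s)"
    if "s \<in> {-h<..<h}"
      "\<And>s. s \<in> {-h<..<h} \<Longrightarrow> ((\<lambda>t. f (t, \<theta>)) has_vector_derivative f' (s, \<theta>)) (at s)"
    for f f' :: "real \<times> real \<Rightarrow> 'b" and s \<theta>
  proof -
    have "((\<lambda>t. f (t, \<theta>)) has_vector_derivative f' (- s, \<theta>)) (at (- s))"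
      using that by auto
    moreover have "((\<lambda>t::real. - t) has_vector_derivative - 1) (at s)"
      by (auto intro!: derivative_eq_intros)
    ultimately show ?thesis
      using vector_diff_chain_at[of uminus "- 1" s "\<lambda>t. f (t, \<theta>)" "f' (- s, \<theta>)"]
      by (simp add: o_def)
  qed
  show ?thesis
  proof
    show "continuous_on ({-h<..<h} \<times> UNIV) (\<lambda>(s, \<theta>). - us (-s, \<theta>))"
      "continuous_on ({-h<..<h} \<times> UNIV) (\<lambda>(s, \<theta>). - ust (-s, \<theta>))"
      using continuous_on_minus[OF c[OF cont(2)]] continuous_on_minus[OF c[OF cont(5)]]
      by (simp_all add: split_beta)
    fix s \<theta> :: real assume s: "s \<in> {-h<..<h}"
    then have s': "- s \<in> {-h<..<h}" by auto
    show "((\<lambda>t. case (t, \<theta>) of (s, \<theta>) \<Rightarrow> u (-s, \<theta>)) has_vector_derivative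
        (case (s, \<theta>) of (s, \<theta>) \<Rightarrow> - us (-s, \<theta>))) (at s)"
      "((\<lambda>t. case (t, \<theta>) of (s, \<theta>) \<Rightarrow> ut (-s, \<theta>)) has_vector_derivative
        (case (s, \<theta>) of (s, \<theta>) \<Rightarrow> - ust (-s, \<theta>))) (at s)"
      using d[OF s deriv_s(1)] d[OF s deriv_s(3)] by simp_all
    show "((\<lambda>t. case (t, \<theta>) of (s, \<theta>) \<Rightarrow> - us (-s, \<theta>)) has_vector_derivative
        (case (s, \<theta>) of (s, \<theta>) \<Rightarrow> uss (-s, \<theta>))) (at s)"
      using has_vector_derivative_minus[OF d[OF s deriv_s(2)]] by simp
    show "((\<lambda>t. case (s, t) of (s, \<theta>) \<Rightarrow> u (-s, \<theta>)) has_vector_derivative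
        (case (s, \<theta>) of (s, \<theta>) \<Rightarrow> ut (-s, \<theta>))) (at \<theta>)"
      "((\<lambda>t. case (s, t) of (s, \<theta>) \<Rightarrow> ut (-s, \<theta>)) has_vector_derivative
        (case (s, \<theta>) of (s, \<theta>) \<Rightarrow> utt (-s, \<theta>))) (at \<theta>)"
      "((\<lambda>t. case (s, t) of (s, \<theta>) \<Rightarrow> - us (-s, \<theta>)) has_vector_derivative
        (case (s, \<theta>) of (s, \<theta>) \<Rightarrow> - ust (-s, \<theta>))) (at \<theta>)"
      using deriv_t[OF s'] has_vector_derivative_minus[OF deriv_t(2)[OF s']] by simp_all
  qed (use c cont periodic in auto)
qed

section \<open>Weight, conjugated derivatives and fluxes\<close>

definition mass :: "real \<Rightarrow> real" where
  "mass s = integral {0..2 * pi} (\<lambda>\<theta>. (norm (u (s, \<theta>)))\<^sup>2)"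

text \<open>This is \<phi>'. The vertex of \<phi> lies at \<open>h + 1\<close>, beyond the strip, so
  that on the strip the weight decreases for \<open>l > 0\<close> and
  \<open>(slope s)\<^sup>2 \<ge> 4\<close>.\<close>

definition slope :: "real \<Rightarrow> real" where
  "slope s = 2 * (s - h - 1)"

definition weight :: "real \<Rightarrow> real \<Rightarrow> real" where
  "weight l s = exp (2 * l * (s - h - 1)\<^sup>2)"

text \<open>With \<phi>' = \<open>slope\<close>, this is \<open>exp (- l * \<phi>)\<close> times the
  s-derivative of \<open>exp (l * \<phi>) u\<close>.\<close>

definition conj_deriv :: "real \<Rightarrow> real \<times> real \<Rightarrow> 'b" where
  "conj_deriv l x = us x + (l * slope (fst x)) *\<^sub>R u x"

definition conj_deriv_s :: "real \<Rightarrow> real \<times> real \<Rightarrow> 'b" where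
  "conj_deriv_s l x = uss x + (l * slope (fst x)) *\<^sub>R us x + (2 * l) *\<^sub>R u x"

text \<open>The Carleman identity has the divergence \<open>\<partial>\<^sub>s (weight * flux_s) + \<partial>\<^sub>\<theta> (weight * flux_t)\<close>;
  \<open>flux_s'\<close> is \<open>\<partial>\<^sub>s (weight * flux_s) / weight\<close> and \<open>flux_t'\<close> is \<open>\<partial>\<^sub>\<theta> flux_t\<close>.\<close>

definition flux_s :: "real \<Rightarrow> real \<times> real \<Rightarrow> real" where
  "flux_s l x = (let p = slope (fst x); v = conj_deriv l x in
     - 2 * l * p * (v \<bullet> v) - 6 * l * (u x \<bullet> v) + 2 * l * p * (ut x \<bullet> ut x)
     - 2 * l^3 * p^3 * (u x \<bullet> u x))"

definition flux_s' :: "real \<Rightarrow> real \<times> real \<Rightarrow> real" where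
  "flux_s' l x = (let p = slope (fst x); v = conj_deriv l x; v' = conj_deriv_s l x in
     2 * l * p * (- 2 * l * p * (v \<bullet> v) - 6 * l * (u x \<bullet> v) + 2 * l * p * (ut x \<bullet> ut x)
       - 2 * l^3 * p^3 * (u x \<bullet> u x))
      - 4 * l * (v \<bullet> v) - 4 * l * p * (v \<bullet> v') - 6 * l * (us x \<bullet> v) - 6 * l * (u x \<bullet> v')
      + 4 * l * (ut x \<bullet> ut x) + 4 * l * p * (ut x \<bullet> ust x) - 12 * l^3 * p^2 * (u x \<bullet> u x)
      - 4 * l^3 * p^3 * (u x \<bullet> us x))"

definition flux_t :: "real \<Rightarrow> real \<times> real \<Rightarrow> real" where
  "flux_t l x = - l * (ut x \<bullet> ((4 * slope (fst x)) *\<^sub>R conj_deriv l x + 6 *\<^sub>R u x))"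

definition flux_t' :: "real \<Rightarrow> real \<times> real \<Rightarrow> real" where
  "flux_t' l x = - l * (utt x \<bullet> ((4 * slope (fst x)) *\<^sub>R conj_deriv l x + 6 *\<^sub>R u x)
     + ut x \<bullet> ((4 * slope (fst x)) *\<^sub>R (ust x + (l * slope (fst x)) *\<^sub>R ut x) + 6 *\<^sub>R ut x))"

section \<open>Derivatives and continuity of the fluxes\<close>

lemma has_real_derivative_slope [derivative_intros]: "(slope has_real_derivative 2) (at s)"
  unfolding slope_def by (auto intro!: derivative_eq_intros)

lemma has_real_derivative_weight:
  "(weight l has_real_derivative 2 * l * slope s * weight l s) (at s)"
  unfolding slope_def weight_def
  by (auto intro!: derivative_eq_intros simp: power2_eq_square algebra_simps)

lemma has_vector_derivative_conj_deriv_s: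
  assumes "s \<in> {-h<..<h}"
  shows "((\<lambda>t. conj_deriv l (t, \<theta>)) has_vector_derivative conj_deriv_s l (s, \<theta>)) (at s)"
proof -
  have "((\<lambda>t. l * slope t) has_real_derivative 2 * l) (at s)"
    by (auto intro!: derivative_eq_intros)
  from has_vector_derivative_add[OF deriv_s(2)[OF assms]
      has_vector_derivative_scaleR[OF this deriv_s(1)[OF assms]]]
  show ?thesis
    unfolding conj_deriv_def conj_deriv_s_def by (simp add: algebra_simps)
qed

lemma has_real_derivative_inner:
  assumes "(f has_vector_derivative f') (at s)" "(g has_vector_derivative g') (at s)"
  shows "((\<lambda>t. f t \<bullet> g t :: real) has_real_derivative f s \<bullet> g' + f' \<bullet> g s) (at s)"
proof -
  have "(\<lambda>h. f s \<bullet> (h *\<^sub>R g') + (h *\<^sub>R f') \<bullet> g s) = (*) (f s \<bullet> g' + f' \<bullet> g s)"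
    by (simp add: fun_eq_iff algebra_simps)
  then show ?thesis
    using has_derivative_inner[OF assms[unfolded has_vector_derivative_def]]
    by (simp add: has_field_derivative_def)
qed

lemma has_real_derivative_flux_s:
  assumes "s \<in> {-h<..<h}"
  shows "((\<lambda>t. weight l t * flux_s l (t, \<theta>)) has_real_derivative weight l s * flux_s' l (s, \<theta>)) (at s)"
proof -
  have two: "3 - Suc 0 = 2" by simp
  show ?thesis
    unfolding flux_s_def Let_def fst_conv
    apply (rule derivative_eq_intros has_real_derivative_weight refl
      has_real_derivative_inner deriv_s[OF assms] has_vector_derivative_conj_deriv_s[OF assms])+
    unfolding flux_s'_def Let_def fst_conv two of_nat_numeral
      inner_commute[of "us (s, \<theta>)" "u (s, \<theta>)"]
      inner_commute[of "ust (s, \<theta>)" "ut (s, \<theta>)"]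
      inner_commute[of "conj_deriv_s l (s, \<theta>)" "conj_deriv l (s, \<theta>)"]
    by algebra
qed

lemma has_real_derivative_flux_t:
  assumes "s \<in> {-h<..<h}"
  shows "((\<lambda>t. flux_t l (s, t)) has_real_derivative flux_t' l (s, \<theta>)) (at \<theta>)"
proof -
  have "((\<lambda>t. (4 * slope s) *\<^sub>R conj_deriv l (s, t) + 6 *\<^sub>R u (s, t)) has_vector_derivative
      (4 * slope s) *\<^sub>R (ust (s, \<theta>) + (l * slope s) *\<^sub>R ut (s, \<theta>)) + 6 *\<^sub>R ut (s, \<theta>)) (at \<theta>)"
    unfolding conj_deriv_def fst_conv
    by (intro has_vector_derivative_add deriv_t[OF assms]
        bounded_linear.has_vector_derivative[OF bounded_linear_scaleR_right])
  from DERIV_cmult[OF has_real_derivative_inner[OF deriv_t(3)[OF assms] this], of "- l"]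
  show ?thesis
    unfolding flux_t_def flux_t'_def by (simp add: algebra_simps)
qed

lemma continuous_slope [continuous_intros]: "continuous_on A f \<Longrightarrow> continuous_on A (\<lambda>x. slope (f x))"
  unfolding slope_def by (intro continuous_intros)

lemma continuous_weight [continuous_intros]:
  "continuous_on A f \<Longrightarrow> continuous_on A (\<lambda>x. weight l (f x))"
  unfolding weight_def by (intro continuous_intros)

lemma continuous_flux:
  "continuous_on ({-h<..<h} \<times> UNIV) (flux_s l)"
  "continuous_on ({-h<..<h} \<times> UNIV) (flux_s' l)"
  "continuous_on ({-h<..<h} \<times> UNIV) (flux_t' l)"
proof -
  note [continuous_intros] = cont
  have [continuous_intros]: "continuous_on ({-h<..<h} \<times> UNIV) (conj_deriv l)"
    "continuous_on ({-h<..<h} \<times> UNIV) (conj_deriv_s l)"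
    unfolding conj_deriv_def conj_deriv_s_def by (intro continuous_intros)+
  show "continuous_on ({-h<..<h} \<times> UNIV) (flux_s l)"
    "continuous_on ({-h<..<h} \<times> UNIV) (flux_s' l)"
    "continuous_on ({-h<..<h} \<times> UNIV) (flux_t' l)"
    unfolding flux_s_def flux_s'_def flux_t'_def Let_def by (intro continuous_intros)+
qed

section \<open>Integration over the circle\<close>

lemma integral_flux_t':
  assumes "s \<in> {-h<..<h}"
  shows "(flux_t' l \<circ> Pair s has_integral 0) {0..2 * pi}"
proof -
  have "((\<lambda>\<theta>. flux_t' l (s, \<theta>)) has_integral (flux_t l (s, 2 * pi) - flux_t l (s, 0))) {0..2 * pi}"
    by (rule fundamental_theorem_of_calculus)
      (auto simp flip: has_real_derivative_iff_has_vector_derivative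
        intro: has_field_derivative_at_within has_real_derivative_flux_t[OF assms])
  then show ?thesis
    by (simp add: flux_t_def conj_deriv_def periodic o_def)
qed

definition flux :: "real \<Rightarrow> real \<Rightarrow> real" where
  "flux l s = integral {0..2 * pi} (\<lambda>\<theta>. weight l s * flux_s l (s, \<theta>))"

lemma has_real_derivative_flux:
  assumes "s \<in> {-h<..<h}"
  shows "(flux l has_real_derivative weight l s * integral {0..2 * pi} (\<lambda>\<theta>. flux_s' l (s, \<theta>))) (at s)"
proof -
  have "((\<lambda>s. integral {0..2 * pi} (\<lambda>\<theta>. weight l (fst (s, \<theta>)) * flux_s l (s, \<theta>)))
      has_vector_derivative
      integral {0..2 * pi} (\<lambda>\<theta>. weight l (fst (s, \<theta>)) * flux_s' l (s, \<theta>))) (at s)"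
    by (rule has_vector_derivative_integral_param[OF _ _ _ assms])
      (auto intro!: continuous_intros continuous_flux has_real_derivative_flux_s
        simp flip: has_real_derivative_iff_has_vector_derivative)
  then show ?thesis
    by (simp add: flux_def[abs_def] has_real_derivative_iff_has_vector_derivative)
qed

text \<open>Since \<open>l \<ge> M\<close>, the Carleman estimate absorbs the gradient terms. On the
  circle the nonlocal term integrates to \<open>2 * pi * M * mass s\<close>, so the total
  coefficient of \<open>mass s\<close> is \<open>M + 2 * pi * M - l\<close>, at most
  \<open>- 1\<close> by the choice of \<open>l\<close>.\<close>

lemma flux_derivative_le:
  assumes s: "s \<in> {-h<..<h}" and M: "M > 0" and l: "l \<ge> 1 + M * (1 + 2 * pi)"
    and diff_ineq: "\<And>\<theta>. (norm (uss (s, \<theta>) + utt (s, \<theta>)))\<^sup>2 \<le>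
      M * ((norm (u (s, \<theta>)))\<^sup>2 + ((norm (us (s, \<theta>)))\<^sup>2 + (norm (ut (s, \<theta>)))\<^sup>2) + mass s)"
  shows "integral {0..2 * pi} (\<lambda>\<theta>. flux_s' l (s, \<theta>)) \<le> - mass s"
proof -
  have "M * 1 \<le> M * (1 + 2 * pi)"
    using M by (intro mult_left_mono) auto
  with M l have l1: "l \<ge> 1" and lM: "l \<ge> M"
    by linarith+
  have "slope s \<le> - 2"
    using s by (simp add: slope_def)
  then have "2\<^sup>2 \<le> (- slope s)\<^sup>2"
    by (intro power_mono) auto
  then have p: "(slope s)\<^sup>2 \<ge> 4" by simp
  have pw: "flux_s' l (s, \<theta>) \<le> (M - l) * (norm (u (s, \<theta>)))\<^sup>2 + M * mass s - flux_t' l (s, \<theta>)" for \<theta>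
  proof -
    have "flux_s' l (s, \<theta>) + flux_t' l (s, \<theta>)
      + l * ((norm (us (s, \<theta>)))\<^sup>2 + (norm (ut (s, \<theta>)))\<^sup>2 + (norm (u (s, \<theta>)))\<^sup>2)
      \<le> (norm (uss (s, \<theta>) + utt (s, \<theta>)))\<^sup>2"
      using carleman_pointwise[OF l1 p, of "us (s, \<theta>)" "u (s, \<theta>)" "ut (s, \<theta>)" "uss (s, \<theta>)"
          "ust (s, \<theta>)" "utt (s, \<theta>)"]
      unfolding flux_s'_def flux_t'_def conj_deriv_def conj_deriv_s_def Let_def fst_conv by simp
    moreover have "M * ((norm (us (s, \<theta>)))\<^sup>2 + (norm (ut (s, \<theta>)))\<^sup>2)
        \<le> l * ((norm (us (s, \<theta>)))\<^sup>2 + (norm (ut (s, \<theta>)))\<^sup>2)"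
      using lM by (intro mult_right_mono) auto
    ultimately show ?thesis
      using diff_ineq[of \<theta>] by (simp add: algebra_simps)
  qed
  have nu: "((\<lambda>\<theta>. (norm (u (s, \<theta>)))\<^sup>2) has_integral mass s) {0..2 * pi}"
    unfolding mass_def
    by (intro integrable_integral integrable_continuous_real continuous_intros
        continuous_on_slice[OF cont(1) s])
  have rhs: "((\<lambda>\<theta>. (M - l) * (norm (u (s, \<theta>)))\<^sup>2 + M * mass s - flux_t' l (s, \<theta>)) has_integral
      (M - l) * mass s + (2 * pi) * (M * mass s) - 0) {0..2 * pi}"
    using has_integral_const_real[of "M * mass s" 0 "2 * pi"] integral_flux_t'[OF s, of l]
    by (intro has_integral_diff has_integral_add has_integral_mult_right nu) (auto simp: o_def)
  have lhs: "((\<lambda>\<theta>. flux_s' l (s, \<theta>)) has_integral integral {0..2 * pi} (\<lambda>\<theta>. flux_s' l (s, \<theta>)))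
      {0..2 * pi}"
    by (intro integrable_integral integrable_continuous_real
        continuous_on_slice[OF continuous_flux(2) s])
  have "integral {0..2 * pi} (\<lambda>\<theta>. flux_s' l (s, \<theta>))
      \<le> (M - l) * mass s + (2 * pi) * (M * mass s) - 0"
    by (rule has_integral_le[OF lhs rhs pw])
  also have "\<dots> = - (l - M * (1 + 2 * pi)) * mass s"
    by (simp add: algebra_simps)
  also have "\<dots> \<le> - 1 * mass s"
    using l by (intro mult_right_mono) (auto simp: mass_def integral_nonneg has_integral_integrable[OF nu])
  finally show ?thesis by simp
qed

text \<open>The terms of \<open>flux_s\<close> of order at least two in \<open>l\<close> have a favourable sign because
  \<open>slope\<close> is negative.\<close>

lemma flux_lower_bound:
  assumes s: "s \<in> {-h<..<h}" and l: "l \<ge> 0"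
  shows "- flux l s \<le> l * weight l s *
    integral {0..2 * pi} (\<lambda>\<theta>. 6 * (u (s, \<theta>) \<bullet> us (s, \<theta>)) - 2 * slope s * (norm (ut (s, \<theta>)))\<^sup>2)"
    (is "_ \<le> _ * integral _ ?B")
proof -
  have p: "slope s \<le> 0" using s by (simp add: slope_def)
  have pw: "weight l s * flux_s l (s, \<theta>) \<ge> - (l * weight l s) * ?B \<theta>" for \<theta>
  proof -
    define a v where "a = u (s, \<theta>)" and "v = conj_deriv l (s, \<theta>)"
    have 1: "l * slope s * (v \<bullet> v) \<le> 0" "l\<^sup>2 * slope s * (a \<bullet> a) \<le> 0"
      "l^3 * slope s ^ 3 * (a \<bullet> a) \<le> 0"
      using p l by (simp_all add: mult_nonpos_nonneg mult_nonneg_nonpos)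
    have 2: "flux_s l (s, \<theta>) = - 2 * (l * slope s * (v \<bullet> v)) - 6 * (l\<^sup>2 * slope s * (a \<bullet> a))
        - 2 * (l^3 * slope s ^ 3 * (a \<bullet> a)) - l * ?B \<theta>"
      unfolding flux_s_def Let_def v_def[symmetric] a_def[symmetric] power2_norm_eq_inner
      by (simp add: v_def conj_deriv_def a_def[symmetric] inner_simps power2_eq_square
          algebra_simps)
    have "- l * ?B \<theta> \<le> flux_s l (s, \<theta>)"
      using 1 unfolding 2 by linarith
    from mult_left_mono[OF this, of "weight l s"]
    show ?thesis by (simp add: weight_def algebra_simps)
  qed
  have "integral {0..2 * pi} (\<lambda>\<theta>. - (l * weight l s) * ?B \<theta>) \<le> flux l s"
    unfolding flux_def using pw
    by (intro integral_le integrable_continuous_real continuous_intros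
        continuous_on_slice[OF cont(1) s] continuous_on_slice[OF cont(2) s]
        continuous_on_slice[OF cont(3) s] continuous_on_slice[OF continuous_flux(1) s])
  then show ?thesis by simp
qed

section \<open>The limit of large \<open>l\<close>\<close>

lemma continuous_on_mass: "continuous_on {-h<..<h} mass"
proof -
  have "continuous_on ({-h<..<h} \<times> cbox 0 (2 * pi)) (\<lambda>(s, \<theta>). (norm (u (s, \<theta>)))\<^sup>2)"
    unfolding split_beta
    by (intro continuous_intros continuous_on_compose2[OF cont(1)]) auto
  from integral_continuous_on_param[OF this] show ?thesis
    by (simp add: mass_def[abs_def])
qed

lemma mass_nonneg: "mass s \<ge> 0"
  \<comment> \<open>\<open>s\<close> is arbitrary here; where the integral fails to exist, its
    default value is 0.\<close>
  unfolding mass_def by (cases "(\<lambda>\<theta>. (norm (u (s, \<theta>)))\<^sup>2) integrable_on {0..2 * pi}")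
    (auto simp: integral_nonneg not_integrable_integral)

lemma weight_antimono:
  assumes "l \<ge> 0" "s \<le> t" "t \<le> h"
  shows "weight l t \<le> weight l s"
proof -
  have "(h + 1 - t)\<^sup>2 \<le> (h + 1 - s)\<^sup>2"
    using assms by (intro power_mono) auto
  then have "(t - h - 1)\<^sup>2 \<le> (s - h - 1)\<^sup>2"
    by (simp add: power2_eq_square algebra_simps)
  then show ?thesis
    using assms by (simp add: weight_def mult_left_mono)
qed

lemma unique_continuation_right:
  assumes M: "M > 0"
    and diff_ineq: "\<And>s \<theta>. s \<in> {0..<h} \<Longrightarrow> (norm (uss (s, \<theta>) + utt (s, \<theta>)))\<^sup>2 \<le>
      M * ((norm (u (s, \<theta>)))\<^sup>2 + ((norm (us (s, \<theta>)))\<^sup>2 + (norm (ut (s, \<theta>)))\<^sup>2) + mass s)"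
    and zero: "\<And>\<theta>. u (0, \<theta>) = 0" "\<And>\<theta>. us (0, \<theta>) = 0" "\<And>\<theta>. ut (0, \<theta>) = 0"
    and t: "0 < t" "t < h" and \<theta>: "\<theta> \<in> {0..2 * pi}"
  shows "u (t, \<theta>) = 0"
proof -
  \<comment> \<open>An intermediate point: the ratio \<open>weight l T / weight l t\<close> decays
    exponentially in \<open>l\<close>, while the data at \<open>T < h\<close> enter only through
    \<open>B\<close>, which is independent of \<open>l\<close>.\<close>
  define T where "T = (t + h) / 2"
  have T: "t < T" "T < h" using t by (auto simp: T_def)
  define Q where "Q = (\<lambda>s. integral {0..s} mass)"
  define B where "B = integral {0..2 * pi}
    (\<lambda>\<theta>. 6 * (u (T, \<theta>) \<bullet> us (T, \<theta>)) - 2 * slope T * (norm (ut (T, \<theta>)))\<^sup>2)"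
  have mc: "continuous_on {0..t} mass"
    by (rule continuous_on_subset[OF continuous_on_mass]) (use t in auto)
  \<comment> \<open>The chain is \<open>weight l t * Q t \<le> - flux l t \<le> - flux l T \<le> l *
    weight l T * B\<close>.\<close>
  have bound: "Q t \<le> l * exp (- 2 * l * ((t - h - 1)\<^sup>2 - (T - h - 1)\<^sup>2)) * B"
    if l: "l \<ge> 1 + M * (1 + 2 * pi)" for l
  proof -
    have "0 \<le> M * (1 + 2 * pi)"
      using M by (intro mult_nonneg_nonneg) auto
    then have l0: "l \<ge> 0" using l by simp
    have dG: "\<exists>y. (flux l has_real_derivative y) (at s) \<and> y \<le> - (weight l s * mass s)"
      if "0 \<le> s" "s < h" for s
    proof -
      have s: "s \<in> {-h<..<h}" using that by auto
      have "weight l s * integral {0..2 * pi} (\<lambda>\<theta>. flux_s' l (s, \<theta>)) \<le> weight l s * (- mass s)"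
        using that by (intro mult_left_mono flux_derivative_le[OF s M l] diff_ineq)
          (auto simp: weight_def)
      then show ?thesis
        using has_real_derivative_flux[OF s, of l] by auto
    qed
    have "flux l T \<le> flux l t"
    proof (rule DERIV_nonpos_imp_nonincreasing[where f = "flux l"])
      fix s assume "t \<le> s" "s \<le> T"
      then obtain y where "(flux l has_real_derivative y) (at s)" "y \<le> - (weight l s * mass s)"
        using dG[of s] t T by auto
      moreover have "0 \<le> weight l s * mass s"
        using mass_nonneg by (simp add: weight_def)
      ultimately show "\<exists>y. (flux l has_real_derivative y) (at s) \<and> y \<le> 0"
        by (intro exI[of _ y]) auto
    qed (use T in auto)
    \<comment> \<open>The weight is frozen at the right end \<open>t\<close>, where it is smallest
      on \<open>{0..t}\<close>, so the decay of \<open>flux l\<close> still outweighs the growth of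
      \<open>weight l t * Q s\<close>.\<close>
    moreover have "flux l t + weight l t * Q t \<le> flux l 0 + weight l t * Q 0"
    proof (rule DERIV_nonpos_imp_decreasing_open[where f = "\<lambda>s. flux l s + weight l t * Q s"])
      fix s assume s: "0 < s" "s < t"
      then obtain y where y: "(flux l has_real_derivative y) (at s)" "y \<le> - (weight l s * mass s)"
        using dG[of s] t by auto
      have "(Q has_real_derivative mass s) (at s within {0..t})"
        unfolding Q_def using s by (intro integral_has_real_derivative mc) auto
      then have "(Q has_real_derivative mass s) (at s)"
        using s by (subst (asm) at_within_interior) auto
      then have "((\<lambda>s. flux l s + weight l t * Q s) has_real_derivative y + weight l t * mass s) (at s)"
        using y by (auto intro!: derivative_eq_intros)
      moreover have "weight l t * mass s \<le> weight l s * mass s"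
        using weight_antimono[OF l0, of s t] s t mass_nonneg by (intro mult_right_mono) auto
      ultimately show "\<exists>y. ((\<lambda>s. flux l s + weight l t * Q s) has_real_derivative y) (at s) \<and> y \<le> 0"
        using y by (intro exI[of _ "y + weight l t * mass s"]) auto
    next
      have "continuous_on {0..t} (flux l)"
      proof (rule continuous_at_imp_continuous_on, rule ballI)
        fix s assume "s \<in> {0..t}"
        then have "0 \<le> s" "s < h" using t by auto
        from dG[OF this] show "isCont (flux l) s"
          using DERIV_isCont by blast
      qed
      moreover have "continuous_on {0..t} Q"
        unfolding Q_def by (intro indefinite_integral_continuous_1 integrable_continuous_real mc)
      ultimately show "continuous_on {0..t} (\<lambda>s. flux l s + weight l t * Q s)"
        by (intro continuous_intros)
    qed (use t in auto)
    moreover have "flux l 0 + weight l t * Q 0 = 0"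
      by (simp_all add: flux_def flux_s_def conj_deriv_def zero Q_def Let_def)
    moreover have "- flux l T \<le> l * weight l T * B"
      unfolding B_def by (rule flux_lower_bound) (use t T l0 in auto)
    ultimately have "weight l t * Q t \<le> l * weight l T * B" by linarith
    then have "Q t \<le> l * (weight l T / weight l t) * B"
      by (simp add: weight_def field_simps)
    also have "weight l T / weight l t = exp (- 2 * l * ((t - h - 1)\<^sup>2 - (T - h - 1)\<^sup>2))"
      by (simp add: weight_def exp_diff[symmetric] algebra_simps)
    finally show ?thesis .
  qed
  \<comment> \<open>The strict gap in the exponent makes the exponential beat the factor
    \<open>l\<close>.\<close>
  have "(h + 1 - T)\<^sup>2 < (h + 1 - t)\<^sup>2"
    using t T by (intro power_strict_mono) auto
  then have "(t - h - 1)\<^sup>2 - (T - h - 1)\<^sup>2 > 0"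
    by (simp add: power2_eq_square algebra_simps)
  then have "((\<lambda>l. l * exp (- 2 * l * ((t - h - 1)\<^sup>2 - (T - h - 1)\<^sup>2)) * B) \<longlongrightarrow> 0) at_top"
    by real_asymp
  moreover have "\<forall>\<^sub>F l in at_top. Q t \<le> l * exp (- 2 * l * ((t - h - 1)\<^sup>2 - (T - h - 1)\<^sup>2)) * B"
    using bound by (rule eventually_at_top_linorderI)
  ultimately have "Q t \<le> 0"
    by (rule tendsto_lowerbound) simp
  moreover have "Q t \<ge> 0"
    unfolding Q_def using mass_nonneg by (intro integral_nonneg integrable_continuous_real mc) auto
  ultimately have "integral {0..t} mass = 0"
    by (simp add: Q_def)
  \<comment> \<open>A continuous nonnegative function with zero integral vanishes, also at the
    endpoint; used in \<open>s\<close> here and in \<theta> below.\<close>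
  then have "mass t = 0"
    using integral_eq_0_iff[OF mc] t mass_nonneg by auto
  moreover have "continuous_on {0..2 * pi} (\<lambda>\<theta>. (norm (u (t, \<theta>)))\<^sup>2)"
    using t by (intro continuous_intros continuous_on_slice[OF cont(1)]) auto
  ultimately have "(norm (u (t, \<theta>)))\<^sup>2 = 0"
    unfolding mass_def using integral_eq_0_iff[of 0 "2 * pi" "\<lambda>\<theta>. (norm (u (t, \<theta>)))\<^sup>2"] \<theta> by auto
  then show ?thesis by simp
qed

end

section \<open>Periodicity and passage from the cylinder to the strip\<close>

lemma in_coords_periodic: "in_coords u (s, \<theta> + 2 * pi) = in_coords u (s, \<theta>)"
  by (simp add: in_coords_def cis.ctr complex_eq_iff)

lemma d_s_periodic:
  assumes "\<And>s \<theta>. f (s, \<theta> + c) = f (s, \<theta>)"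
  shows "d_s f (s, \<theta> + c) = d_s f (s, \<theta>)"
  by (simp add: d_s_def assms)

lemma has_vector_derivative_at_shift:
  assumes "(f has_vector_derivative D) (at (x + c))"
  shows "((\<lambda>t. f (t + c)) has_vector_derivative D) (at (x::real))"
proof -
  have "((\<lambda>t. t + c) has_vector_derivative 1) (at x)"
    by (auto intro!: derivative_eq_intros)
  from vector_diff_chain_at[OF this assms] show ?thesis
    by (simp add: o_def)
qed

text \<open>The same vectors \<open>D\<close> are derivatives at \<theta> and at
  \<open>\<theta> + c\<close>, so \<open>vector_derivative\<close> picks the same value at both
  points, even where no derivative exists.\<close>

lemma d_theta_periodic:
  assumes "\<And>s \<theta>. f (s, \<theta> + c) = f (s, \<theta>)"
  shows "d_theta f (s, \<theta> + c) = d_theta f (s, \<theta>)"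
proof -
  have "f (s, t - c) = f (s, t)" for t
    using assms[of s "t - c"] by simp
  then have "((\<lambda>t. f (s, t)) has_vector_derivative D) (at (\<theta> + c)) \<longleftrightarrow>
      ((\<lambda>t. f (s, t)) has_vector_derivative D) (at \<theta>)" for D
    using has_vector_derivative_at_shift[of "\<lambda>t. f (s, t)" D \<theta> c]
      has_vector_derivative_at_shift[of "\<lambda>t. f (s, t)" D "\<theta> + c" "- c"]
    by (auto simp: assms)
  then show ?thesis by (simp add: d_theta_def vector_derivative_def)
qed

lemma strip_function_in_coords:
  fixes u :: "real \<times> complex \<Rightarrow> 'b::euclidean_space"
  assumes "smooth_on_cylinder h u"
  defines "f \<equiv> in_coords u"
  shows "strip_function h f (d_s f) (d_theta f) (d_s (d_s f)) (d_theta (d_s f)) (d_theta (d_theta f))"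
proof -
  let ?S = "{-h<..<h} \<times> (UNIV :: real set)"
  have S: "open ?S" by (intro open_Times) auto
  have f: "Cinf_on ?S f"
    using assms by (simp add: smooth_on_cylinder_def)
  note fs = Cinf_on_d_s[OF S f] and ft = Cinf_on_d_theta[OF S f]
  note fss = Cinf_on_d_s[OF S fs(1)] and fts = Cinf_on_d_theta[OF S fs(1)]
    and fst' = Cinf_on_d_s[OF S ft(1)] and ftt = Cinf_on_d_theta[OF S ft(1)]
  \<comment> \<open>Lets \<open>d_theta (d_s f)\<close> serve in both roles of
    \<open>ust\<close>.\<close>
  have mixed: "d_s (d_theta f) (s, \<theta>) = d_theta (d_s f) (s, \<theta>)" if "s \<in> {-h<..<h}" for s \<theta>
    by (rule mixed_partials_commute[where a = "-h" and b = h and f = f and fs = "d_s f"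
          and ft = "d_theta f"])
      (use that fs ft fst' fts in \<open>auto intro: Cinf_on_continuous\<close>)
  have per: "f (s, \<theta> + 2 * pi) = f (s, \<theta>)" for s \<theta>
    unfolding f_def by (rule in_coords_periodic)
  show ?thesis
  proof
    show "((\<lambda>t. d_theta f (t, \<theta>)) has_vector_derivative d_theta (d_s f) (s, \<theta>)) (at s)"
      if "s \<in> {-h<..<h}" for s \<theta>
      using fst'(2)[of s \<theta>] mixed[OF that] that by simp
  qed (use per[of _ 0] d_s_periodic[OF per, of _ 0] d_theta_periodic[OF per, of _ 0] fs ft fss fts ftt f
      in \<open>auto intro: Cinf_on_continuous\<close>)
qed

theorem theoremC:
  fixes h M :: real and u :: "real \<times> complex \<Rightarrow> complex ^ 'n"
  assumes "h > 0" and "M > 0"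
    and "smooth_on_cylinder h u"
    and "\<And>s \<theta>. s \<in> {-h<..<h} \<Longrightarrow>
           (norm (laplacian (in_coords u) (s, \<theta>)))\<^sup>2 \<le>
             M * ((norm (in_coords u (s, \<theta>)))\<^sup>2 + grad_norm_sq (in_coords u) (s, \<theta>)
                  + integral {0..2 * pi} (\<lambda>\<tau>. (norm (in_coords u (s, \<tau>)))\<^sup>2))"
    and "\<And>i j \<theta>. (d_s ^^ i) ((d_theta ^^ j) (in_coords u)) (0, \<theta>) = 0"
  shows "\<forall>p \<in> cylinder h. u p = 0"
proof -
  define f where "f = in_coords u"
  interpret R: strip_function h f "d_s f" "d_theta f" "d_s (d_s f)" "d_theta (d_s f)"
    "d_theta (d_theta f)"
    unfolding f_def by (rule strip_function_in_coords[OF assms(3)])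
  interpret L: strip_function h "\<lambda>(s, \<theta>). f (-s, \<theta>)" "\<lambda>(s, \<theta>). - d_s f (-s, \<theta>)"
    "\<lambda>(s, \<theta>). d_theta f (-s, \<theta>)" "\<lambda>(s, \<theta>). d_s (d_s f) (-s, \<theta>)"
    "\<lambda>(s, \<theta>). - d_theta (d_s f) (-s, \<theta>)" "\<lambda>(s, \<theta>). d_theta (d_theta f) (-s, \<theta>)"
    by (rule R.reflect)
  have ineq: "(norm (d_s (d_s f) (s, \<theta>) + d_theta (d_theta f) (s, \<theta>)))\<^sup>2 \<le>
      M * ((norm (f (s, \<theta>)))\<^sup>2 + ((norm (d_s f (s, \<theta>)))\<^sup>2 + (norm (d_theta f (s, \<theta>)))\<^sup>2)
        + R.mass s)" if "s \<in> {-h<..<h}" for s \<theta>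
    using assms(4)[OF that, of \<theta>]
    unfolding laplacian_def grad_norm_sq_def R.mass_def f_def[symmetric] .
  \<comment> \<open>These are the data that make \<open>flux l 0\<close> vanish.\<close>
  have zero: "f (0, \<theta>) = 0" "d_s f (0, \<theta>) = 0" "d_theta f (0, \<theta>) = 0" for \<theta>
    using assms(5)[of 0 0] assms(5)[of 1 0] assms(5)[of 0 1] by (simp_all add: f_def)
  have mass: "L.mass s = R.mass (- s)" for s
    by (simp add: L.mass_def R.mass_def)
  have right: "f (s, \<theta>) = 0" if "0 < s" "s < h" "\<theta> \<in> {0..2 * pi}" for s \<theta>
    by (rule R.unique_continuation_right[OF assms(2) ineq zero that]) (use assms(1) in auto)
  \<comment> \<open>The inequality for the reflected function at \<open>s\<close> is
    \<open>ineq\<close> at \<open>- s\<close>; the sign of the s-derivative disappears in the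
    norm.\<close>
  have left: "f (- s, \<theta>) = 0" if "0 < s" "s < h" "\<theta> \<in> {0..2 * pi}" for s \<theta>
    using L.unique_continuation_right[OF assms(2) _ _ _ _ that] ineq[of "- _"] zero
    by (auto simp: mass)
  have f0: "f (s, \<theta>) = 0" if "s \<in> {-h<..<h}" "\<theta> \<in> {0..2 * pi}" for s \<theta>
    using right[of s \<theta>] left[of "- s" \<theta>] zero(1)[of \<theta>] that by (cases s "0::real" rule: linorder_cases) auto
  show ?thesis
  proof
    fix x assume "x \<in> cylinder h"
    then obtain s z where x: "x = (s, z)" "s \<in> {-h<..<h}" "norm z = 1"
      by (auto simp: cylinder_def)
    \<comment> \<open>Every point of the circle has an angle in \<open>{0..2 * pi}\<close>, so
      vanishing of \<open>f\<close> there covers the whole cylinder.\<close>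
    then have "cis (Arg2pi z) = z"
      using Arg2pi_eq[of z] by (simp add: cis_conv_exp)
    moreover have "Arg2pi z \<in> {0..2 * pi}"
      using Arg2pi_ge_0[of z] Arg2pi_lt_2pi[of z] by simp
    ultimately show "u x = 0"
      using f0[OF x(2), of "Arg2pi z"] by (simp add: f_def in_coords_def x(1))
  qed
qed

end
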